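(* Let $m,n\ge 2$ be integers, let $S=\{s_{1},s_{2},\ldots,s_{n}\}$ be a set of $n$ distinct positive integers, and let $\mathcal{T}_{[S]}=(t_{i_1\ldots i_m})$ be the $m$th-order $n$-dimensional GCD tensor on $S$. Then for every positive real number $r$, the fractional Hadamard power $\mathcal{T}_{[S]}^{\circ r}=(t_{i_1 i_2\ldots i_m}^{\,r})$ is strongly completely positive.
   Context: $\mathbb{R}^{[m,n]}$ denotes the set of real $m$th-order $n$-dimensional tensors $\mathcal{A}=(a_{i_1 i_2\ldots i_m})$, $1\le i_1,\ldots,i_m\le n$. $\mathbb{R}^n_+$ is the set of (entrywise) nonnegative vectors in $\mathbb{R}^n$. GCD tensor: for $S=\{s_1,\ldots,s_n\}$ with $n$ distinct positive integers (listed in a fixed order), $\mathcal{T}_{[S]}=(t_{i_1\ldots i_m})\in\mathbb{R}^{[m,n]}$ with $t_{i_1 i_2\ldots i_m}=\gcd(s_{i_1},s_{i_2},\ldots,s_{i_m})$. For $v\in\mathbb{R}^n$, $v^{\otimes m}\in\mathbb{R}^{[m,n]}$ is the $m$-fold outer product, with entries $v_{i_1}v_{i_2}\cdots v_{i_m}$. A symmetric tensor $\mathcal{A}\in\mathbb{R}^{[m,n]}$ (entries invariant under permutation of the indices) is completely positive (CP) if there exist $v_1,\ldots,v_r\in\mathbb{R}^n_+$ with $\mathcal{A}=(v_1)^{\otimes m}+\cdots+(v_r)^{\otimes m}$. If moreover the vectors can be chosen with $\mathrm{span}\{v_1,\ldots,v_r\}=\mathbb{R}^n$, then $\mathcal{A}$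 is strongly completely positive. *)

theory Defs
  imports "HOL-Analysis.Analysis"
begin

text \<open>
  Real tensors of order \<open>CARD('m)\<close> and dimension \<open>CARD('n)\<close>: a multi-index
  \<open>(i\<^sub>1, \<dots>, i\<^sub>m)\<close> is a function from the positions \<open>'m\<close> to the indices \<open>'n\<close>.
\<close>

type_synonym ('m, 'n) tensor = "(real, 'm \<Rightarrow> 'n) vec"

definition symmetric_tensor :: "('m::finite, 'n::finite) tensor \<Rightarrow> bool" where
  "symmetric_tensor A \<longleftrightarrow> (\<forall>\<sigma> i. bij \<sigma> \<longrightarrow> A $ (i \<circ> \<sigma>) = A $ i)"

definition outer_power :: "real ^ 'n \<Rightarrow> ('m::finite, 'n::finite) tensor" where
  "outer_power v = (\<chi> i. \<Prod>k\<in>UNIV. v $ i k)"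

definition nonneg_decomposition ::
    "('m::finite, 'n::finite) tensor \<Rightarrow> (real ^ 'n) list \<Rightarrow> bool" where
  "nonneg_decomposition A vs \<longleftrightarrow>
     (\<forall>v\<in>set vs. \<forall>j. 0 \<le> v $ j) \<and> A = (\<Sum>v\<leftarrow>vs. outer_power v)"

definition completely_positive :: "('m::finite, 'n::finite) tensor \<Rightarrow> bool" where
  "completely_positive A \<longleftrightarrow> symmetric_tensor A \<and> (\<exists>vs. nonneg_decomposition A vs)"

definition strongly_completely_positive :: "('m::finite, 'n::finite) tensor \<Rightarrow> bool" where
  "strongly_completely_positive A \<longleftrightarrow>
     completely_positive A \<and> (\<exists>vs. nonneg_decomposition A vs \<and> span (set vs) = UNIV)"

definition gcd_tensor :: "('n \<Rightarrow> nat) \<Rightarrow> ('m::finite, 'n::finite) tensor" where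
  "gcd_tensor s = (\<chi> i. real (GCD k. s (i k)))"

text \<open>Meant for entrywise nonnegative tensors and \<open>r > 0\<close>, where \<open>powr\<close> is the usual power.\<close>

definition hadamard_power :: "('m::finite, 'n::finite) tensor \<Rightarrow> real \<Rightarrow> ('m, 'n) tensor" where
  "hadamard_power A r = (\<chi> i. (A $ i) powr r)"

end

theory Submission
  imports Defs "HOL-Computational_Algebra.Primes"
begin

text \<open>
  The idea is to write \<open>n powr r\<close> as a divisor sum \<open>\<Sum>d | d dvd n. J d\<close> with positive
  weights \<open>J d\<close>. Since \<open>d\<close> divides a gcd exactly if it divides every argument, this turns each
  entry \<open>gcd(s\<^sub>i\<^sub>1, \<dots>, s\<^sub>i\<^sub>m) powr r\<close> into
  \<open>\<Sum>d. J d * [d dvd s\<^sub>i\<^sub>1] * \<cdots> * [d dvd s\<^sub>i\<^sub>m]\<close>, and so the whole tensor is the sum of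
  the \<open>m\<close>-th outer powers of the nonnegative vectors \<open>root m (J d) * ([d dvd s\<^sub>j])\<^sub>j\<close>, where
  \<open>d\<close> ranges over the divisors of the elements of \<open>S\<close>.

  The weights are given by Jordan's totient function with a real exponent: the Euler product
  \<open>n powr r * (\<Prod>p | p prime factor of n. 1 - p powr -r)\<close> (lemma \<open>sum_jordan_divisors\<close>);
  its factors \<open>1 - p powr -r\<close> are positive because \<open>r > 0\<close>. The vectors span because the incidence
  matrix \<open>[s\<^sub>j dvd s\<^sub>i]\<close> is unitriangular once \<open>S\<close> is sorted (lemma \<open>span_divisor_vecs\<close>).
\<close>

section \<open>Jordan's totient function with a real exponent\<close>

definition jordan :: "real \<Rightarrow> nat \<Rightarrow> real" where
  "jordan r n = real n powr r * (\<Prod>p\<in>prime_factors n. 1 - real p powr - r)"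

lemma jordan_1 [simp]: "jordan r (Suc 0) = 1"
  by (simp add: jordan_def)

lemma jordan_pos:
  assumes "r > 0" "n > 0"
  shows "jordan r n > 0"
proof -
  have "1 - real p powr - r > 0" if "p \<in> prime_factors n" for p
  proof -
    have "real p > 1"
      using that prime_gt_1_nat[of p] by auto
    then show ?thesis
      using assms by (simp add: powr_less_one)
  qed
  then show ?thesis
    using assms unfolding jordan_def by (intro mult_pos_pos prod_pos) auto
qed

lemma jordan_prime_power_mult:
  assumes "prime p" "\<not> p dvd d"
  shows "jordan r (p ^ Suc k * d) = (real (p ^ Suc k) powr r - real (p ^ k) powr r) * jordan r d"
proof -
  have p: "real p > 0"
    using assms(1) prime_gt_0_nat by auto
  have "d \<noteq> 0"
    using assms(2) by (intro notI) simp
  then have "prime_factors (p ^ Suc k * d) = insert p (prime_factors d)"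
    using assms(1)
    by (subst prime_factors_product) (simp_all add: prime_factorization_prime_power del: power_Suc)
  moreover have "p \<notin> prime_factors d"
    using assms(2) by auto
  moreover have "real (p ^ Suc k) powr r * real p powr - r = real (p ^ k) powr r"
    using p by (simp add: powr_mult powr_minus)
  ultimately show ?thesis
    unfolding jordan_def by (simp add: powr_mult algebra_simps del: power_Suc)
qed

text \<open>
  The divisors of \<open>p ^ Suc k * m\<close> that are not already divisors of \<open>p ^ k * m\<close> carry the full
  power of \<open>p\<close>.
\<close>

lemma divisors_prime_power_mult:
  fixes p m :: nat
  assumes "prime p" "\<not> p dvd m"
  shows "{d. d dvd p ^ Suc k * m} = {d. d dvd p ^ k * m} \<union> (\<lambda>d. p ^ Suc k * d) ` {d. d dvd m}"
    and "{d. d dvd p ^ k * m} \<inter> (\<lambda>d. p ^ Suc k * d) ` {d. d dvd m} = {}"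
proof -
  have p0: "p \<noteq> 0"
    using assms(1) by (intro notI) simp
  have "d dvd p ^ k * m \<or> d \<in> (\<lambda>d. p ^ Suc k * d) ` {d. d dvd m}"
    if d: "d dvd p ^ Suc k * m" for d
  proof -
    obtain a b where ab: "d = a * b" "a dvd p ^ Suc k" "b dvd m"
      using division_decomp[OF d] by blast
    obtain j where j: "j \<le> Suc k" "a = p ^ j"
      using ab(2) divides_primepow_nat[OF assms(1)] by blast
    show ?thesis
    proof (cases "j = Suc k")
      case True
      then show ?thesis
        using ab j by auto
    next
      case False
      then have "p ^ j dvd p ^ k"
        using j by (intro le_imp_power_dvd) simp
      then show ?thesis
        using ab j by (simp add: mult_dvd_mono)
    qed
  qed
  moreover have "p ^ k * m dvd p ^ Suc k * m"
    by simp
  moreover have "p ^ Suc k * d dvd p ^ Suc k * m" if "d dvd m" for d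
    using that by (rule mult_dvd_mono[OF dvd_refl])
  ultimately show "{d. d dvd p ^ Suc k * m} =
      {d. d dvd p ^ k * m} \<union> (\<lambda>d. p ^ Suc k * d) ` {d. d dvd m}"
    using dvd_trans by blast
  have "\<not> p ^ Suc k * d dvd p ^ k * m" for d
  proof
    assume "p ^ Suc k * d dvd p ^ k * m"
    then have "p ^ k * (p * d) dvd p ^ k * m"
      by (simp add: mult_ac)
    then have "p * d dvd m"
      using p0 by simp
    then show False
      using assms(2) dvd_mult_left by blast
  qed
  then show "{d. d dvd p ^ k * m} \<inter> (\<lambda>d. p ^ Suc k * d) ` {d. d dvd m} = {}"
    by auto
qed

text \<open>
  Write \<open>n = p ^ Suc k * m\<close> with \<open>p\<close> not dividing \<open>m\<close>. Splitting the divisors as above reduces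
  the sum for \<open>n\<close> to those for the smaller numbers \<open>p ^ k * m\<close> and \<open>m\<close>, and the contributions
  telescope.
\<close>

lemma sum_jordan_divisors:
  assumes "n > 0"
  shows "(\<Sum>d | d dvd n. jordan r d) = real n powr r"
  using assms
proof (induction n rule: less_induct)
  case (less n)
  show ?case
  proof (cases "n = 1")
    case True
    then show ?thesis
      by simp
  next
    case False
    then obtain p where p: "prime p" "p dvd n"
      using prime_factor_nat by blast
    have "\<not> is_unit p"
      using p(1) not_prime_unit by blast
    then obtain m where m: "n = p ^ multiplicity p n * m" "\<not> p dvd m"
      using less.prems multiplicity_decompose'[of n p] by auto
    have "multiplicity p n \<noteq> 0"
      using less.prems p by (simp add: prime_multiplicity_gt_zero_iff)
    then obtain k where "multiplicity p n = Suc k"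
      using not0_implies_Suc by blast
    then have n: "n = p ^ Suc k * m"
      using m(1) by simp
    have m0: "m > 0"
      using m(2) by (intro gr0I) simp
    have p1: "p > 1"
      using p(1) by (rule prime_gt_1_nat)
    have pk: "p ^ k > 0"
      using p1 by simp
    have "p ^ k < p ^ Suc k" "1 < p ^ Suc k"
      using p1 one_less_power[of p "Suc k"] by simp_all
    then have lt: "p ^ k * m < n" "m < n"
      unfolding n using m0 by (simp_all del: power_Suc)
    let ?c = "real (p ^ Suc k) powr r - real (p ^ k) powr r"
    have "(\<Sum>d | d dvd n. jordan r d) = (\<Sum>d | d dvd p ^ k * m. jordan r d)
        + (\<Sum>d\<in>(\<lambda>d. p ^ Suc k * d) ` {d. d dvd m}. jordan r d)"
      unfolding n divisors_prime_power_mult(1)[OF p(1) m(2)]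
      using m0 pk divisors_prime_power_mult(2)[OF p(1) m(2)]
      by (intro sum.union_disjoint) auto
    also have "(\<Sum>d\<in>(\<lambda>d. p ^ Suc k * d) ` {d. d dvd m}. jordan r d)
        = (\<Sum>d | d dvd m. jordan r (p ^ Suc k * d))"
      using p1 by (subst sum.reindex) (auto simp: inj_on_def)
    also have "\<dots> = (\<Sum>d | d dvd m. ?c * jordan r d)"
    proof (rule sum.cong[OF refl])
      fix d assume "d \<in> {d. d dvd m}"
      then have "\<not> p dvd d"
        using m(2) dvd_trans by blast
      then show "jordan r (p ^ Suc k * d) = ?c * jordan r d"
        by (rule jordan_prime_power_mult[OF p(1)])
    qed
    also have "\<dots> = ?c * real m powr r"
      using less.IH[OF lt(2) m0] by (simp add: sum_distrib_left[symmetric])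
    also have "(\<Sum>d | d dvd p ^ k * m. jordan r d) = real (p ^ k * m) powr r"
      using less.IH[OF lt(1)] m0 pk by simp
    also have "real (p ^ k * m) powr r + ?c * real m powr r = real n powr r"
      unfolding n by (simp add: powr_mult algebra_simps)
    finally show ?thesis .
  qed
qed

section \<open>Divisibility vectors\<close>

definition divisor_vec :: "('n \<Rightarrow> nat) \<Rightarrow> (nat \<Rightarrow> real) \<Rightarrow> nat \<Rightarrow> real ^ 'n" where
  "divisor_vec s c d = (\<chi> j. if d dvd s j then c d else 0)"

text \<open>
  Up to a nonzero factor, the vector of \<open>d = s j\<close> is the unit vector of \<open>j\<close> plus unit vectors of
  indices with larger values of \<open>s\<close>, namely of the proper multiples of \<open>s j\<close>. So the unit
  vectors are obtained one after another, from the largest value of \<open>s\<close> downwards.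
\<close>

lemma span_divisor_vecs:
  fixes s :: "'n::finite \<Rightarrow> nat"
  assumes "inj s" and pos: "\<And>j. s j > 0" and c: "\<And>j. c (s j) \<noteq> 0" and D: "range s \<subseteq> D"
  shows "span (divisor_vec s c ` D) = UNIV"
proof -
  let ?V = "span (divisor_vec s c ` D)"
  have unit: "axis j (1::real) \<in> ?V" for j
  proof (induction j rule: measure_induct_rule[where f = "\<lambda>j. Max (range s) - s j"])
    case (less j)
    let ?I = "{i. s j dvd s i}"
    have "axis i (1::real) \<in> ?V" if "i \<in> ?I - {j}" for i
    proof (rule less.IH)
      have "s j \<noteq> s i"
        using that assms(1) by (auto dest: injD)
      moreover have "s j \<le> s i"
        using that pos by (auto intro: dvd_imp_le)
      moreover have "s i \<le> Max (range s)"
        by simp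
      ultimately show "Max (range s) - s i < Max (range s) - s j"
        by linarith
    qed
    then have rest: "(\<Sum>i\<in>?I - {j}. axis i (1::real)) \<in> ?V"
      by (rule span_sum)
    have "divisor_vec s c (s j) \<in> ?V"
      using D by (intro span_base) auto
    moreover have "divisor_vec s c (s j) = c (s j) *\<^sub>R (\<Sum>i\<in>?I. axis i 1)"
      by (simp add: divisor_vec_def vec_eq_iff axis_def)
    ultimately have "(\<Sum>i\<in>?I. axis i (1::real)) \<in> ?V"
      using span_mul[of _ "divisor_vec s c ` D" "inverse (c (s j))"] c[of j] by fastforce
    moreover have "(\<Sum>i\<in>?I. axis i (1::real)) = axis j 1 + (\<Sum>i\<in>?I - {j}. axis i 1)"
      by (rule sum.remove) auto
    ultimately show ?case
      using span_diff[OF _ rest] by fastforce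
  qed
  have "(Basis :: (real ^ 'n) set) \<subseteq> ?V"
    using unit by (auto simp: Basis_vec_def)
  then show ?thesis
    using span_mono span_span span_Basis by (metis top.extremum_uniqueI)
qed

lemma outer_power_divisor_vec:
  "(outer_power (divisor_vec s c d) :: ('m::finite, 'n::finite) tensor) $ i
     = (if d dvd (GCD k. s (i k)) then c d ^ CARD('m) else 0)"
  by (cases "\<forall>k. d dvd s (i k)") (auto simp: outer_power_def divisor_vec_def dvd_Gcd_iff)

section \<open>Complete positivity of the powers of gcd tensors\<close>

lemma symmetric_hadamard_power_gcd_tensor:
  "symmetric_tensor (hadamard_power (gcd_tensor s :: ('m::finite, 'n::finite) tensor) r)"
proof -
  have "range (\<lambda>k. s ((i \<circ> \<sigma>) k)) = range (\<lambda>k. s (i k))" if "bij \<sigma>"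
    for \<sigma> :: "'m \<Rightarrow> 'm" and i :: "'m \<Rightarrow> 'n"
    using bij_is_surj[OF that] by (metis (no_types) fun.set_map image_image)
  then show ?thesis
    by (simp add: symmetric_tensor_def hadamard_power_def gcd_tensor_def)
qed

theorem theorem1p5:
  fixes s :: "'n::finite \<Rightarrow> nat" and r :: real
  assumes "CARD('m::finite) \<ge> 2" and "CARD('n) \<ge> 2"
    and "inj s" and "\<And>j. s j > 0"
    and "r > 0"
  shows "strongly_completely_positive (hadamard_power (gcd_tensor s :: ('m, 'n) tensor) r)"
proof -
  let ?T = "hadamard_power (gcd_tensor s :: ('m, 'n) tensor) r"
  define D where "D = {d. \<exists>j. d dvd s j}"
  define c where "c d = root CARD('m) (jordan r d)" for d
  have "D = (\<Union>j. {d. d dvd s j})"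
    by (auto simp: D_def)
  then have "finite D"
    using assms(4) by simp
  then obtain ds where ds: "set ds = D" "distinct ds"
    using finite_distinct_list by blast
  have D_pos: "d > 0" if "d \<in> D" for d
    using that assms(4) by (auto simp: D_def intro: dvd_pos_nat)
  have c_pos: "c d > 0" and c_power: "c d ^ CARD('m) = jordan r d" if "d > 0" for d
    using jordan_pos[OF assms(5) that] by (simp_all add: c_def real_root_pow_pos)
  define vs where "vs = map (divisor_vec s c) ds"
  have "?T = (\<Sum>v\<leftarrow>vs. outer_power v)"
  proof (rule vec_eq_iff[THEN iffD2], rule allI)
    fix i :: "'m \<Rightarrow> 'n"
    let ?g = "GCD k. s (i k)"
    have g_dvd: "?g dvd s (i k)" for k
      by (rule Gcd_dvd) simp
    then have "?g > 0"
      using assms(4) dvd_pos_nat by blast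
    have sub: "{d. d dvd ?g} \<subseteq> D"
      using g_dvd dvd_trans unfolding D_def by blast
    have "(\<Sum>v\<leftarrow>vs. outer_power v) = (\<Sum>d\<in>D. outer_power (divisor_vec s c d) :: ('m, 'n) tensor)"
      using ds by (simp add: vs_def sum_list_distinct_conv_sum_set o_def)
    then have "(\<Sum>v\<leftarrow>vs. outer_power v :: ('m, 'n) tensor) $ i
        = (\<Sum>d\<in>D. if d dvd ?g then c d ^ CARD('m) else 0)"
      by (simp add: outer_power_divisor_vec)
    also have "\<dots> = (\<Sum>d | d dvd ?g. c d ^ CARD('m))"
      using sub \<open>finite D\<close> by (simp add: sum.inter_filter[symmetric] Int_absorb1 Collect_conj_eq)
    also have "\<dots> = (\<Sum>d | d dvd ?g. jordan r d)"
      using sub D_pos by (intro sum.cong c_power) auto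
    also have "\<dots> = real ?g powr r"
      using \<open>?g > 0\<close> by (rule sum_jordan_divisors)
    finally show "?T $ i = (\<Sum>v\<leftarrow>vs. outer_power v :: ('m, 'n) tensor) $ i"
      by (simp add: hadamard_power_def gcd_tensor_def)
  qed
  moreover have "\<forall>v\<in>set vs. \<forall>j. 0 \<le> v $ j"
    using ds D_pos c_pos by (auto simp: vs_def divisor_vec_def less_imp_le)
  ultimately have dec: "nonneg_decomposition ?T vs"
    by (simp add: nonneg_decomposition_def)
  have "range s \<subseteq> D"
    unfolding D_def using dvd_refl by blast
  then have "span (set vs) = UNIV"
    using span_divisor_vecs[OF assms(3,4), of c D] c_pos[OF assms(4)] ds
    by (simp add: vs_def less_imp_neq[symmetric])
  then show ?thesis
    using dec symmetric_hadamard_power_gcd_tensor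
    unfolding strongly_completely_positive_def completely_positive_def by blast
qed

end
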